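(* Let $n\ge 2$. On the semigroup $\mathcal{SS}'_n$ we have $\mathcal{J}^*=\mathcal{D}^*$.
   Context: Let $[n]=\{1,2,\dots,n\}$ with its usual order. $\mathcal{P}_n$ is the semigroup of all partial transformations of $[n]$ (maps whose domain and image are subsets of $[n]$, including the empty map), composed from left to right: $x(\alpha\beta)=(x\alpha)\beta$. A partial map $\alpha$ is isotone if $x\le y$ implies $x\alpha\le y\alpha$ for all $x,y\in\mathrm{Dom}\,\alpha$, and order-decreasing if $x\alpha\le x$ for all $x\in\mathrm{Dom}\,\alpha$. $\mathcal{LS}_n$ is the monoid of all isotone order-decreasing $\alpha\in\mathcal{P}_n$, and $\mathcal{SS}'_n=\{\alpha\in\mathcal{LS}_n: 1\notin \mathrm{Dom}\,\alpha\}$, a subsemigroup of $\mathcal{LS}_n$. For a semigroup $S$, $S^1$ is $S$ with an identity adjoined if necessary. $(a,b)\in\mathcal{L}^*$ iff for all $x,y\in S^1$: $ax=ay\iff bx=by$. $(a,b)\in\mathcal{R}^*$ iff for all $x,y\in S^1$: $xa=ya\iff xb=yb$. $\mathcal{D}^*$ is the join of $\mathcal{L}^*$ and $\mathcal{R}^*$ (the smallest equivalence relation containing both). Write $L^*_a$, $R^*_a$ for the $\mathcal{L}^*$-class and $\mathcal{R}^*$-class of $a$. A left (resp. right) $*$-ideal of $S$ is a left (resp. right) ideal $I$ of $S$ such that $L^*_a\subseteq I$ (resp. $R^*_a\subseteq I$) for all $a\in I$; a $*$-ideal is a subset that is both a left and a right $*$-ideal. $J^*(a)$ is the intersection of all $*$-ideals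 of $S$ containing $a$, and $a\,\mathcal{J}^*\,b$ iff $J^*(a)=J^*(b)$. *)

theory Defs
  imports Main
begin

section \<open>Starred Green's relations\<close>

text \<open>
  A semigroup is given by a carrier \<open>S\<close> and a multiplication \<open>f\<close>, assumed closed
  and associative on \<open>S\<close>. In \<open>S\<^sup>1\<close> the element \<open>s \<in> S\<close> is represented by \<open>Some s\<close>, and \<open>None\<close> is the
  adjoined identity, which is present only if \<open>S\<close> has no identity of its own.
\<close>

definition has_identity :: "'a set \<Rightarrow> ('a \<Rightarrow> 'a \<Rightarrow> 'a) \<Rightarrow> bool" where
  "has_identity S f \<longleftrightarrow> (\<exists>e\<in>S. \<forall>x\<in>S. f e x = x \<and> f x e = x)"

definition carrier1 :: "'a set \<Rightarrow> ('a \<Rightarrow> 'a \<Rightarrow> 'a) \<Rightarrow> 'a option set" where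
  "carrier1 S f = (if has_identity S f then Some ` S else insert None (Some ` S))"

fun mult1 :: "('a \<Rightarrow> 'a \<Rightarrow> 'a) \<Rightarrow> 'a option \<Rightarrow> 'a option \<Rightarrow> 'a option" where
  "mult1 f None y = y"
| "mult1 f x None = x"
| "mult1 f (Some x) (Some y) = Some (f x y)"

definition Lstar :: "'a set \<Rightarrow> ('a \<Rightarrow> 'a \<Rightarrow> 'a) \<Rightarrow> ('a \<times> 'a) set" where
  "Lstar S f = {(a, b). a \<in> S \<and> b \<in> S \<and>
     (\<forall>x\<in>carrier1 S f. \<forall>y\<in>carrier1 S f.
        mult1 f (Some a) x = mult1 f (Some a) y \<longleftrightarrow> mult1 f (Some b) x = mult1 f (Some b) y)}"

definition Rstar :: "'a set \<Rightarrow> ('a \<Rightarrow> 'a \<Rightarrow> 'a) \<Rightarrow> ('a \<times> 'a) set" where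
  "Rstar S f = {(a, b). a \<in> S \<and> b \<in> S \<and>
     (\<forall>x\<in>carrier1 S f. \<forall>y\<in>carrier1 S f.
        mult1 f x (Some a) = mult1 f y (Some a) \<longleftrightarrow> mult1 f x (Some b) = mult1 f y (Some b))}"

definition Dstar :: "'a set \<Rightarrow> ('a \<Rightarrow> 'a \<Rightarrow> 'a) \<Rightarrow> ('a \<times> 'a) set" where
  "Dstar S f = \<Inter>{E. equiv S E \<and> Lstar S f \<subseteq> E \<and> Rstar S f \<subseteq> E}"

definition left_ideal :: "'a set \<Rightarrow> ('a \<Rightarrow> 'a \<Rightarrow> 'a) \<Rightarrow> 'a set \<Rightarrow> bool" where
  "left_ideal S f I \<longleftrightarrow> I \<noteq> {} \<and> I \<subseteq> S \<and> (\<forall>s\<in>S. \<forall>a\<in>I. f s a \<in> I)"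

definition right_ideal :: "'a set \<Rightarrow> ('a \<Rightarrow> 'a \<Rightarrow> 'a) \<Rightarrow> 'a set \<Rightarrow> bool" where
  "right_ideal S f I \<longleftrightarrow> I \<noteq> {} \<and> I \<subseteq> S \<and> (\<forall>a\<in>I. \<forall>s\<in>S. f a s \<in> I)"

definition left_star_ideal :: "'a set \<Rightarrow> ('a \<Rightarrow> 'a \<Rightarrow> 'a) \<Rightarrow> 'a set \<Rightarrow> bool" where
  "left_star_ideal S f I \<longleftrightarrow> left_ideal S f I \<and> (\<forall>a\<in>I. Lstar S f `` {a} \<subseteq> I)"

definition right_star_ideal :: "'a set \<Rightarrow> ('a \<Rightarrow> 'a \<Rightarrow> 'a) \<Rightarrow> 'a set \<Rightarrow> bool" where
  "right_star_ideal S f I \<longleftrightarrow> right_ideal S f I \<and> (\<forall>a\<in>I. Rstar S f `` {a} \<subseteq> I)"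

definition star_ideal :: "'a set \<Rightarrow> ('a \<Rightarrow> 'a \<Rightarrow> 'a) \<Rightarrow> 'a set \<Rightarrow> bool" where
  "star_ideal S f I \<longleftrightarrow> left_star_ideal S f I \<and> right_star_ideal S f I"

definition principal_star_ideal :: "'a set \<Rightarrow> ('a \<Rightarrow> 'a \<Rightarrow> 'a) \<Rightarrow> 'a \<Rightarrow> 'a set" where
  "principal_star_ideal S f a = \<Inter>{I. star_ideal S f I \<and> a \<in> I}"

definition Jstar :: "'a set \<Rightarrow> ('a \<Rightarrow> 'a \<Rightarrow> 'a) \<Rightarrow> ('a \<times> 'a) set" where
  "Jstar S f = {(a, b). a \<in> S \<and> b \<in> S \<and> principal_star_ideal S f a = principal_star_ideal S f b}"

section \<open>Isotone order-decreasing partial transformations\<close>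

text \<open>
  Partial transformations are composed from left to right, i.e. \<open>x(\<alpha>\<beta>) = (x\<alpha>)\<beta>\<close>, whereas
  \<open>\<circ>\<^sub>m\<close> composes from right to left.
\<close>

definition pcomp :: "(nat \<rightharpoonup> nat) \<Rightarrow> (nat \<rightharpoonup> nat) \<Rightarrow> (nat \<rightharpoonup> nat)" where
  "pcomp \<alpha> \<beta> = \<beta> \<circ>\<^sub>m \<alpha>"

definition partial_transformations :: "nat \<Rightarrow> (nat \<rightharpoonup> nat) set" where
  "partial_transformations n = {\<alpha>. dom \<alpha> \<subseteq> {1..n} \<and> ran \<alpha> \<subseteq> {1..n}}"

definition isotone :: "(nat \<rightharpoonup> nat) \<Rightarrow> bool" where
  "isotone \<alpha> \<longleftrightarrow> mono_on (dom \<alpha>) (\<lambda>x. the (\<alpha> x))"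

definition order_decreasing :: "(nat \<rightharpoonup> nat) \<Rightarrow> bool" where
  "order_decreasing \<alpha> \<longleftrightarrow> (\<forall>x\<in>dom \<alpha>. the (\<alpha> x) \<le> x)"

definition LS :: "nat \<Rightarrow> (nat \<rightharpoonup> nat) set" where
  "LS n = {\<alpha> \<in> partial_transformations n. isotone \<alpha> \<and> order_decreasing \<alpha>}"

definition SS' :: "nat \<Rightarrow> (nat \<rightharpoonup> nat) set" where
  "SS' n = {\<alpha> \<in> LS n. 1 \<notin> dom \<alpha>}"

lemma pcomp_assoc: "pcomp (pcomp \<alpha> \<beta>) \<gamma> = pcomp \<alpha> (pcomp \<beta> \<gamma>)"
  by (auto simp: pcomp_def map_comp_def split: option.split)

lemma pcomp_closed_SS':
  assumes "\<alpha> \<in> SS' n" "\<beta> \<in> SS' n"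
  shows "pcomp \<alpha> \<beta> \<in> SS' n"
proof -
  have app: "\<exists>z. \<alpha> x = Some z \<and> \<beta> z = Some y" if "pcomp \<alpha> \<beta> x = Some y" for x y
    using that by (auto simp: pcomp_def map_comp_Some_iff)
  have le: "y \<le> x" if "\<gamma> \<in> SS' n" "\<gamma> x = Some y" for \<gamma> x y
    using that by (force simp: SS'_def LS_def order_decreasing_def dom_def)
  have iso: "y \<le> y'" if "\<gamma> \<in> SS' n" "\<gamma> x = Some y" "\<gamma> x' = Some y'" "x \<le> x'" for \<gamma> x y x' y'
    using that monotone_onD[of "dom \<gamma>" "(\<le>)" "(\<le>)" "\<lambda>x. the (\<gamma> x)" x x']
    by (auto simp: SS'_def LS_def isotone_def dom_def)
  have "dom (pcomp \<alpha> \<beta>) \<subseteq> dom \<alpha>" "ran (pcomp \<alpha> \<beta>) \<subseteq> ran \<beta>"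
    using app by (fastforce simp: dom_def ran_def)+
  then have "pcomp \<alpha> \<beta> \<in> partial_transformations n" "1 \<notin> dom (pcomp \<alpha> \<beta>)"
    using assms by (auto simp: SS'_def LS_def partial_transformations_def)
  moreover have "isotone (pcomp \<alpha> \<beta>)"
    unfolding isotone_def
  proof (rule monotone_onI)
    fix x x' assume "x \<in> dom (pcomp \<alpha> \<beta>)" "x' \<in> dom (pcomp \<alpha> \<beta>)" "x \<le> x'"
    then obtain y y' where y: "pcomp \<alpha> \<beta> x = Some y" "pcomp \<alpha> \<beta> x' = Some y'" by auto
    have "y \<le> y'"
      using app[OF y(1)] app[OF y(2)] iso[OF assms(1)] iso[OF assms(2)] \<open>x \<le> x'\<close> by meson
    then show "the (pcomp \<alpha> \<beta> x) \<le> the (pcomp \<alpha> \<beta> x')" using y by simp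
  qed
  moreover have "order_decreasing (pcomp \<alpha> \<beta>)"
    unfolding order_decreasing_def
  proof
    fix x assume "x \<in> dom (pcomp \<alpha> \<beta>)"
    then obtain y where y: "pcomp \<alpha> \<beta> x = Some y" by auto
    have "y \<le> x" using app[OF y] le[OF assms(1)] le[OF assms(2)] by (meson le_trans)
    then show "the (pcomp \<alpha> \<beta> x) \<le> x" using y by simp
  qed
  ultimately show ?thesis by (simp add: SS'_def LS_def)
qed

end

theory Submission
  imports Defs
begin

text \<open>
  \<open>\<L>\<^sup>*\<close> is equality of images and \<open>\<R>\<^sup>*\<close> is equality of kernels, so both preserve the rank, i.e. the
  size of the image. Conversely, a map of rank \<open>k\<close> is \<open>\<R>\<^sup>*\<close>-related to the map with the same kernel
  and image \<open>{1..k}\<close>, and any two maps with image \<open>{1..k}\<close> are \<open>\<L>\<^sup>*\<close>-related; hence \<open>\<D>\<^sup>*\<close> is equality of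
  ranks. Since the maps of rank at most \<open>k\<close> form a \<open>*\<close>-ideal, \<open>\<J>\<^sup>*\<close> preserves the rank too.
\<close>

section \<open>The inclusion that holds for every carrier and multiplication\<close>

text \<open>\<open>Jstar\<close> is itself an equivalence containing \<open>Lstar\<close> and
  \<open>Rstar\<close>: a star ideal that contains one of two related elements contains the other,
  so both lie in the same star ideals.\<close>

lemma Dstar_subset_Jstar: "Dstar S f \<subseteq> Jstar S f"
proof -
  have "equiv S (Jstar S f)"
    by (rule equivI) (auto simp: Jstar_def refl_on_def sym_def trans_def)
  moreover have "Lstar S f \<subseteq> Jstar S f"
  proof clarify
    fix a b assume ab: "(a, b) \<in> Lstar S f"
    then have "(b, a) \<in> Lstar S f" by (auto simp: Lstar_def)
    with ab have "star_ideal S f I \<and> a \<in> I \<longleftrightarrow> star_ideal S f I \<and> b \<in> I" for I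
      by (auto simp: star_ideal_def left_star_ideal_def)
    with ab show "(a, b) \<in> Jstar S f"
      by (auto simp: Jstar_def principal_star_ideal_def Lstar_def)
  qed
  moreover have "Rstar S f \<subseteq> Jstar S f"
  proof clarify
    fix a b assume ab: "(a, b) \<in> Rstar S f"
    then have "(b, a) \<in> Rstar S f" by (auto simp: Rstar_def)
    with ab have "star_ideal S f I \<and> a \<in> I \<longleftrightarrow> star_ideal S f I \<and> b \<in> I" for I
      by (auto simp: star_ideal_def right_star_ideal_def)
    with ab show "(a, b) \<in> Jstar S f"
      by (auto simp: Jstar_def principal_star_ideal_def Rstar_def)
  qed
  ultimately show ?thesis by (auto simp: Dstar_def)
qed

section \<open>Elements of \<open>SS' n\<close>\<close>

text \<open>A pointwise form of the definition; the bound \<open>2 \<le> x\<close> combines the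
  lower end of \<open>{1..n}\<close> with the exclusion of 1 from the domain.\<close>

lemma mem_SS'_iff:
  "a \<in> SS' n \<longleftrightarrow>
     (\<forall>x y. a x = Some y \<longrightarrow> 2 \<le> x \<and> x \<le> n \<and> 1 \<le> y \<and> y \<le> x) \<and>
     (\<forall>x x' y y'. a x = Some y \<longrightarrow> a x' = Some y' \<longrightarrow> x \<le> x' \<longrightarrow> y \<le> y')"
  (is "_ \<longleftrightarrow> ?B \<and> ?M")
proof
  assume a: "a \<in> SS' n"
  then have "dom a \<subseteq> {1..n}" "ran a \<subseteq> {1..n}" "1 \<notin> dom a"
    and dec: "\<And>x. x \<in> dom a \<Longrightarrow> the (a x) \<le> x"
    and iso: "mono_on (dom a) (\<lambda>x. the (a x))"
    by (simp_all add: SS'_def LS_def partial_transformations_def order_decreasing_def isotone_def)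
  have ?B
  proof (intro allI impI)
    fix x y assume xy: "a x = Some y"
    then have "x \<in> dom a" "y \<in> ran a" by (auto simp: ran_def)
    then have "x \<in> {1..n}" "y \<in> {1..n}" "x \<noteq> 1" "y \<le> x"
      using \<open>dom a \<subseteq> _\<close> \<open>ran a \<subseteq> _\<close> \<open>1 \<notin> dom a\<close> dec[of x] xy by auto
    then show "2 \<le> x \<and> x \<le> n \<and> 1 \<le> y \<and> y \<le> x" by auto
  qed
  moreover have ?M
    using monotone_onD[OF iso] by (metis domI option.sel)
  ultimately show "?B \<and> ?M" by blast
next
  assume *: "?B \<and> ?M"
  then have "dom a \<subseteq> {1..n}" "1 \<notin> dom a" "ran a \<subseteq> {1..n}"
    by (fastforce simp: ran_def)+
  moreover have "isotone a"
    using * unfolding isotone_def by (auto intro!: monotone_onI)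
  moreover have "order_decreasing a"
    using * by (auto simp: order_decreasing_def)
  ultimately show "a \<in> SS' n"
    by (simp add: SS'_def LS_def partial_transformations_def)
qed

text \<open>Partial identities are the multipliers that will detect images; the singleton maps below
  will detect kernels.\<close>

lemma restrict_id_mem_SS': "A \<subseteq> {2..n} \<Longrightarrow> Some |` A \<in> SS' n"
  by (fastforce simp: mem_SS'_iff restrict_map_def split: if_splits)

lemma singleton_mem_SS': "1 \<le> y \<Longrightarrow> y \<le> x \<Longrightarrow> 2 \<le> x \<Longrightarrow> x \<le> n \<Longrightarrow> [x \<mapsto> y] \<in> SS' n"
  by (auto simp: mem_SS'_iff split: if_splits)

lemma ran_SS'_subset: "a \<in> SS' n \<Longrightarrow> ran a \<subseteq> {1..n}"
  by (simp add: SS'_def LS_def partial_transformations_def)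

lemma SS'_zero: "a \<in> SS' n \<Longrightarrow> a 0 = None"
  by (cases "a 0") (auto simp: mem_SS'_iff)

lemma finite_ran_SS': "a \<in> SS' n \<Longrightarrow> finite (ran a)"
  using ran_SS'_subset finite_subset by blast

text \<open>A right identity would have to fix 1, the image point of \<open>[2 \<mapsto> 1]\<close>,
  but 1 is in no domain. Hence \<open>None\<close> belongs to \<open>carrier1\<close>.\<close>

lemma SS'_no_identity:
  assumes "2 \<le> n"
  shows "\<not> has_identity (SS' n) pcomp"
proof
  assume "has_identity (SS' n) pcomp"
  then obtain e where e: "e \<in> SS' n" "\<forall>x\<in>SS' n. pcomp x e = x"
    by (auto simp: has_identity_def)
  have "[2 \<mapsto> 1] \<in> SS' n" using assms by (simp add: singleton_mem_SS')
  with e(2) have "pcomp [2 \<mapsto> 1] e = [2 \<mapsto> 1]" by blast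
  from fun_cong[OF this, of 2]
  have "e 1 = Some 1" by (simp add: pcomp_def map_comp_def)
  moreover have "1 \<notin> dom e" using e(1) by (simp add: SS'_def)
  ultimately show False by auto
qed

section \<open>Left cancellation and images\<close>

text \<open>The adjoined identity acts as the identity map of the whole type, which lies outside \<open>SS' n\<close>.\<close>

definition map_of_elem1 :: "(nat \<rightharpoonup> nat) option \<Rightarrow> (nat \<rightharpoonup> nat)" where
  "map_of_elem1 x = (case x of None \<Rightarrow> Some | Some u \<Rightarrow> u)"

lemma map_of_elem1_simps [simp]:
  "map_of_elem1 None = Some" "map_of_elem1 (Some u) = u"
  by (simp_all add: map_of_elem1_def)

lemma mult1_pcomp:
  "mult1 pcomp (Some a) x = Some (pcomp a (map_of_elem1 x))"
  "mult1 pcomp x (Some a) = Some (pcomp (map_of_elem1 x) a)"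
  by (cases x; auto simp: pcomp_def map_comp_def fun_eq_iff split: option.split)+

text \<open>Only the image of \<open>a\<close> matters for cancelling \<open>a\<close> on the left,
  which is why \<open>Lstar\<close> compares images.\<close>

lemma pcomp_left_eq_iff: "pcomp a u = pcomp a v \<longleftrightarrow> (\<forall>z\<in>ran a. u z = v z)"
proof -
  have "pcomp a u = pcomp a v \<longleftrightarrow> (\<forall>x z. a x = Some z \<longrightarrow> u z = v z)"
    by (auto simp: pcomp_def map_comp_def fun_eq_iff split: option.split)
  then show ?thesis by (auto simp: ran_def)
qed

lemma ran_subset_of_Lstar:
  assumes "2 \<le> n" "(a, b) \<in> Lstar (SS' n) pcomp"
  shows "ran a \<subseteq> ran b"
proof (rule subsetI, rule ccontr)
  fix z assume z: "z \<in> ran a" "z \<notin> ran b"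
  \<comment> \<open>On \<open>{1..n}\<close> the two multipliers differ exactly at \<open>z\<close>.
    For \<open>z = 1\<close> one of them must be defined at 1, which only the adjoined identity
    is.\<close>
  define x where "x = (if z = 1 then None else Some (Some |` {2..n}))"
  define y where "y = Some (Some |` ({2..n} - {z}))"
  have ab: "a \<in> SS' n" "b \<in> SS' n" using assms(2) by (auto simp: Lstar_def)
  have "x \<in> carrier1 (SS' n) pcomp" "y \<in> carrier1 (SS' n) pcomp"
    using SS'_no_identity[OF assms(1)]
    by (auto simp: x_def y_def carrier1_def intro!: imageI restrict_id_mem_SS')
  then have "(\<forall>w\<in>ran a. map_of_elem1 x w = map_of_elem1 y w) \<longleftrightarrow>
      (\<forall>w\<in>ran b. map_of_elem1 x w = map_of_elem1 y w)"
    using assms(2) by (auto simp: Lstar_def mult1_pcomp pcomp_left_eq_iff)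
  moreover have "map_of_elem1 x w = map_of_elem1 y w" if "w \<in> ran b" for w
  proof -
    have "w \<noteq> z" "1 \<le> w" "w \<le> n" using that z(2) ran_SS'_subset[OF ab(2)] by auto
    then show ?thesis by (auto simp: x_def y_def restrict_map_def)
  qed
  moreover have "map_of_elem1 x z \<noteq> map_of_elem1 y z"
  proof -
    have "1 \<le> z" "z \<le> n" using z(1) ran_SS'_subset[OF ab(1)] by auto
    then show ?thesis by (auto simp: x_def y_def restrict_map_def)
  qed
  ultimately show False using z(1) by blast
qed

lemma Lstar_SS'_iff:
  assumes "2 \<le> n"
  shows "(a, b) \<in> Lstar (SS' n) pcomp \<longleftrightarrow> a \<in> SS' n \<and> b \<in> SS' n \<and> ran a = ran b"
proof
  assume ab: "(a, b) \<in> Lstar (SS' n) pcomp"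
  then have "(b, a) \<in> Lstar (SS' n) pcomp" by (auto simp: Lstar_def)
  with ab show "a \<in> SS' n \<and> b \<in> SS' n \<and> ran a = ran b"
    using ran_subset_of_Lstar[OF assms] by (force simp: Lstar_def)
qed (auto simp: Lstar_def mult1_pcomp pcomp_left_eq_iff)

section \<open>Right cancellation and kernels\<close>

text \<open>
  As \<open>0\<close> is never in the domain, it stands in for undefined values; so the kernel condition
  \<open>a z = a w \<longleftrightarrow> b z = b w\<close> over all \<open>z\<close> and \<open>w\<close> also forces equal domains.
\<close>

lemma pcomp_apply_SS':
  "a \<in> SS' n \<Longrightarrow> pcomp u a x = a (case u x of None \<Rightarrow> 0 | Some z \<Rightarrow> z)"
  by (simp add: SS'_zero pcomp_def map_comp_def split: option.split)

text \<open>For \<open>z \<le> w\<close>, the product of \<open>[w \<mapsto> z]\<close> and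
  \<open>a\<close> has value \<open>a z\<close> at \<open>w\<close> and is undefined elsewhere, so
  suitable products express each equality of values of \<open>a\<close>.\<close>

lemma kernel_subset_of_Rstar:
  assumes "(a, b) \<in> Rstar (SS' n) pcomp" "a z = a w"
  shows "b z = b w"
proof -
  have ab: "a \<in> SS' n" "b \<in> SS' n" using assms(1) by (auto simp: Rstar_def)
  then have out: "2 \<le> z \<and> z \<le> n" if "a z \<noteq> None \<or> b z \<noteq> None" for z
    using that by (auto simp: mem_SS'_iff)
  have cancel: "pcomp u b = pcomp v b"
    if "u \<in> SS' n" "v \<in> SS' n" "pcomp u a = pcomp v a" for u v
  proof -
    have carrier: "Some u \<in> carrier1 (SS' n) pcomp" "Some v \<in> carrier1 (SS' n) pcomp"
      using that by (auto simp: carrier1_def)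
    have "mult1 pcomp (Some u) (Some a) = mult1 pcomp (Some v) (Some a) \<longleftrightarrow>
        mult1 pcomp (Some u) (Some b) = mult1 pcomp (Some v) (Some b)"
      using assms(1) carrier unfolding Rstar_def by blast
    then show ?thesis using that(3) by simp
  qed
  \<comment> \<open>The empty map is the partner that tests whether \<open>a\<close> is undefined at
    \<open>z\<close>.\<close>
  have none: "b z = None" if "a z = None" for z
  proof (rule ccontr)
    assume nn: "b z \<noteq> None"
    have "[z \<mapsto> z] \<in> SS' n" using out[of z] nn by (simp add: singleton_mem_SS')
    moreover have "Map.empty \<in> SS' n" by (simp add: mem_SS'_iff)
    moreover have "pcomp [z \<mapsto> z] a = pcomp Map.empty a"
      using that by (auto simp: pcomp_def map_comp_def)
    ultimately have "pcomp [z \<mapsto> z] b = pcomp Map.empty b" by (rule cancel)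
    from fun_cong[OF this, of z] nn show False by (simp add: pcomp_def map_comp_def)
  qed
  \<comment> \<open>\<open>[w \<mapsto> z]\<close> is order-decreasing because
    \<open>z \<le> w\<close>; the opposite order follows by symmetry at the end.\<close>
  have le: "b z = b w" if "a z = a w" "a w \<noteq> None" "z \<le> w" for z w
  proof -
    have "[w \<mapsto> z] \<in> SS' n" "[w \<mapsto> w] \<in> SS' n"
      using out[of z] out[of w] that by (auto intro!: singleton_mem_SS')
    moreover have "pcomp [w \<mapsto> z] a = pcomp [w \<mapsto> w] a"
      using that by (auto simp: pcomp_def map_comp_def)
    ultimately have "pcomp [w \<mapsto> z] b = pcomp [w \<mapsto> w] b" by (rule cancel)
    from fun_cong[OF this, of w] show ?thesis by (simp add: pcomp_def map_comp_def)
  qed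
  show ?thesis
  proof (cases "a w = None")
    case True
    with assms(2) show ?thesis by (simp add: none)
  next
    case False
    consider "z \<le> w" | "w \<le> z" by linarith
    then show ?thesis
    proof cases
      case 1
      with False assms(2) show ?thesis by (intro le)
    next
      case 2
      with False assms(2) have "b w = b z" by (intro le) simp_all
      then show ?thesis by simp
    qed
  qed
qed

lemma Rstar_SS'_iff:
  "(a, b) \<in> Rstar (SS' n) pcomp \<longleftrightarrow>
     a \<in> SS' n \<and> b \<in> SS' n \<and> (\<forall>z w. a z = a w \<longleftrightarrow> b z = b w)"
proof
  assume ab: "(a, b) \<in> Rstar (SS' n) pcomp"
  then have ba: "(b, a) \<in> Rstar (SS' n) pcomp" by (auto simp: Rstar_def)
  have "a \<in> SS' n" "b \<in> SS' n" using ab by (auto simp: Rstar_def)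
  then show "a \<in> SS' n \<and> b \<in> SS' n \<and> (\<forall>z w. a z = a w \<longleftrightarrow> b z = b w)"
    using kernel_subset_of_Rstar[OF ab] kernel_subset_of_Rstar[OF ba] by blast
next
  assume "a \<in> SS' n \<and> b \<in> SS' n \<and> (\<forall>z w. a z = a w \<longleftrightarrow> b z = b w)"
  then show "(a, b) \<in> Rstar (SS' n) pcomp"
    by (auto simp: Rstar_def mult1_pcomp fun_eq_iff pcomp_apply_SS')
qed

text \<open>Sending a value of \<open>a\<close> to the value of \<open>b\<close> at a chosen
  preimage maps \<open>ran a\<close> onto a superset of \<open>ran b\<close>: by the kernel
  inclusion the choice does not affect the result.\<close>

lemma card_ran_le_of_kernel:
  assumes "finite (ran a)" "\<And>z w. a z = a w \<Longrightarrow> b z = b w" "dom b \<subseteq> dom a"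
  shows "card (ran b) \<le> card (ran a)"
proof (rule surj_card_le[OF assms(1)])
  show "ran b \<subseteq> (\<lambda>v. the (b (SOME x. a x = Some v))) ` ran a"
  proof
    fix y assume "y \<in> ran b"
    then obtain x where x: "b x = Some y" by (auto simp: ran_def)
    with assms(3) obtain v where v: "a x = Some v" by auto
    then have "a (SOME x. a x = Some v) = Some v" by (rule someI)
    with v x assms(2) have "b (SOME x. a x = Some v) = Some y" by metis
    with v show "y \<in> (\<lambda>v. the (b (SOME x. a x = Some v))) ` ran a"
      by (force simp: ran_def)
  qed
qed

lemma card_ran_Rstar:
  assumes "(a, b) \<in> Rstar (SS' n) pcomp"
  shows "card (ran a) = card (ran b)"
proof -
  have ab: "a \<in> SS' n" "b \<in> SS' n" and ker: "\<And>z w. a z = a w \<longleftrightarrow> b z = b w"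
    using assms by (auto simp: Rstar_SS'_iff)
  have "a 0 = None" "b 0 = None"
    using ab by (simp_all add: SS'_zero)
  \<comment> \<open>Being undefined at \<open>z\<close> means having the same value at
    \<open>z\<close> as at 0.\<close>
  with ker[of _ 0] have "dom a = dom b" by (simp add: dom_def)
  then show ?thesis
    using card_ran_le_of_kernel[of a b] card_ran_le_of_kernel[of b a] ker
      finite_ran_SS'[OF ab(1)] finite_ran_SS'[OF ab(2)] by (simp add: order_antisym)
qed

text \<open>Replacing each value of \<open>a\<close> by its position in the image keeps the map order-decreasing.\<close>

lemma ex_Rstar_initial_ran:
  assumes a: "a \<in> SS' n"
  shows "\<exists>c. (a, c) \<in> Rstar (SS' n) pcomp \<and> ran c = {1..card (ran a)}"
proof -
  \<comment> \<open>For \<open>v\<close> in the image, \<open>h v\<close> is its position in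
    increasing order, counted from 1.\<close>
  define h where "h v = card {y \<in> ran a. y \<le> v}" for v
  define c where "c x = map_option h (a x)" for x
  note fin = finite_ran_SS'[OF a]
  have mono: "h v \<le> h w" if "v \<le> w" for v w
    unfolding h_def using that fin by (intro card_mono) auto
  have strict: "h v < h w" if "v < w" "w \<in> ran a" for v w
    unfolding h_def
  proof (rule psubset_card_mono)
    show "{y \<in> ran a. y \<le> v} \<subset> {y \<in> ran a. y \<le> w}"
    proof
      show "{y \<in> ran a. y \<le> v} \<subseteq> {y \<in> ran a. y \<le> w}" using that(1) by auto
      have "w \<in> {y \<in> ran a. y \<le> w}" "w \<notin> {y \<in> ran a. y \<le> v}" using that by simp_all
      then show "{y \<in> ran a. y \<le> v} \<noteq> {y \<in> ran a. y \<le> w}" by blast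
    qed
  qed (use fin in simp)
  have inj: "inj_on h (ran a)"
    by (intro linorder_inj_onI' less_imp_neq strict)
  \<comment> \<open>Image points are positive, so at most \<open>v\<close> of them are
    \<open>\<le> v\<close>; this makes \<open>c\<close> order-decreasing.\<close>
  have le: "h v \<le> v" for v
  proof -
    have "{y \<in> ran a. y \<le> v} \<subseteq> {1..v}" using ran_SS'_subset[OF a] by auto
    then have "h v \<le> card {1..v}" unfolding h_def by (intro card_mono) auto
    then show ?thesis by simp
  qed
  have pos: "1 \<le> h v" if "v \<in> ran a" for v
  proof -
    have "{y \<in> ran a. y \<le> v} \<noteq> {}" using that by auto
    then show ?thesis unfolding h_def using fin by (simp add: Suc_le_eq card_gt_0_iff)
  qed
  have "h v \<le> card (ran a)" for v unfolding h_def using fin by (intro card_mono) auto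
  then have "h ` ran a \<subseteq> {1..card (ran a)}" using pos by auto
  \<comment> \<open>An injection between finite sets of equal size is onto.\<close>
  then have "h ` ran a = {1..card (ran a)}"
    by (intro card_subset_eq) (simp_all add: card_image[OF inj])
  moreover have "ran c = h ` ran a" by (auto simp: ran_def c_def)
  moreover have "c \<in> SS' n"
    unfolding mem_SS'_iff
  proof (intro conjI[of "\<forall>x y. _ x y"] allI impI)
    fix x y assume "c x = Some y"
    then obtain v where v: "a x = Some v" "y = h v" by (auto simp: c_def)
    then have "v \<in> ran a" by (auto simp: ran_def)
    with v a pos[of v] le[of v] show "2 \<le> x \<and> x \<le> n \<and> 1 \<le> y \<and> y \<le> x"
      by (auto simp: mem_SS'_iff intro: order_trans)
  next
    fix x x' y y' assume "c x = Some y" "c x' = Some y'" "x \<le> x'"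
    with a show "y \<le> y'" by (auto simp: c_def mem_SS'_iff intro!: mono)
  qed
  moreover have "a z = a w \<longleftrightarrow> c z = c w" for z w
    using inj by (cases "a z"; cases "a w") (auto simp: c_def ran_def inj_on_def)
  ultimately show ?thesis using a by (auto simp: Rstar_SS'_iff)
qed

lemma Dstar_if_card_ran_eq:
  assumes "2 \<le> n" "a \<in> SS' n" "b \<in> SS' n" "card (ran a) = card (ran b)"
  shows "(a, b) \<in> Dstar (SS' n) pcomp"
  unfolding Dstar_def
proof clarify
  fix E assume E: "equiv (SS' n) E" "Lstar (SS' n) pcomp \<subseteq> E" "Rstar (SS' n) pcomp \<subseteq> E"
  obtain c where c: "(a, c) \<in> Rstar (SS' n) pcomp" "ran c = {1..card (ran a)}"
    using ex_Rstar_initial_ran[OF assms(2)] by blast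
  obtain d where d: "(b, d) \<in> Rstar (SS' n) pcomp" "ran d = {1..card (ran b)}"
    using ex_Rstar_initial_ran[OF assms(3)] by blast
  \<comment> \<open>Equal ranks give \<open>c\<close> and \<open>d\<close> the same image, which
    links \<open>a\<close> to \<open>b\<close> through \<open>c\<close> and \<open>d\<close> inside
    every such \<open>E\<close>.\<close>
  have "(c, d) \<in> Lstar (SS' n) pcomp"
    using c d assms(4) by (simp add: Lstar_SS'_iff[OF assms(1)] Rstar_SS'_iff)
  with c(1) d(1) E have "(a, c) \<in> E" "(c, d) \<in> E" "(b, d) \<in> E" by auto
  then show "(a, b) \<in> E"
    using E(1) by (meson equivE symD transD)
qed

section \<open>Star ideals given by bounded rank\<close>

text \<open>Multiplying on the left shrinks the image, and multiplying on the right maps it forward,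
  so neither raises the rank; \<open>Lstar\<close> and \<open>Rstar\<close> preserve it.\<close>

lemma star_ideal_card_ran_le:
  assumes "2 \<le> n"
  shows "star_ideal (SS' n) pcomp {a \<in> SS' n. card (ran a) \<le> k}"
proof -
  let ?I = "{a \<in> SS' n. card (ran a) \<le> k}"
  have "Map.empty \<in> ?I" by (simp add: mem_SS'_iff)
  then have ne: "?I \<noteq> {}" by blast
  have left: "card (ran (pcomp s a)) \<le> card (ran a)" if "a \<in> SS' n" for s a
  proof (rule card_mono[OF finite_ran_SS'[OF that]])
    show "ran (pcomp s a) \<subseteq> ran a" by (auto simp: pcomp_def ran_def map_comp_Some_iff)
  qed
  have right: "card (ran (pcomp a s)) \<le> card (ran a)" if "a \<in> SS' n" for s a
  proof (rule surj_card_le[OF finite_ran_SS'[OF that]])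
    show "ran (pcomp a s) \<subseteq> (\<lambda>y. the (s y)) ` ran a"
      by (force simp: pcomp_def ran_def map_comp_Some_iff)
  qed
  have "left_ideal (SS' n) pcomp ?I" "right_ideal (SS' n) pcomp ?I"
    using ne by (auto simp: left_ideal_def right_ideal_def pcomp_closed_SS'
        intro: order_trans[OF left] order_trans[OF right])
  moreover have "Lstar (SS' n) pcomp `` {a} \<subseteq> ?I" if "a \<in> ?I" for a
    using that by (auto simp: Lstar_SS'_iff[OF assms])
  moreover have "Rstar (SS' n) pcomp `` {a} \<subseteq> ?I" if "a \<in> ?I" for a
  proof clarify
    fix b assume "(a, b) \<in> Rstar (SS' n) pcomp"
    with that show "b \<in> SS' n \<and> card (ran b) \<le> k"
      using card_ran_Rstar[of a b n] by (simp add: Rstar_SS'_iff)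
  qed
  ultimately show ?thesis
    unfolding star_ideal_def left_star_ideal_def right_star_ideal_def by blast
qed

text \<open>The maps of rank at most that of \<open>a\<close> form one of the star ideals being
  intersected.\<close>

lemma card_ran_le_if_mem_principal_star_ideal:
  assumes "2 \<le> n" "a \<in> SS' n" "b \<in> principal_star_ideal (SS' n) pcomp a"
  shows "card (ran b) \<le> card (ran a)"
  using assms(2,3) star_ideal_card_ran_le[OF assms(1), of "card (ran a)"]
  by (auto simp: principal_star_ideal_def)

theorem lemma2p17:
  fixes n :: nat
  assumes "n \<ge> 2"
  shows "Jstar (SS' n) pcomp = Dstar (SS' n) pcomp"
proof
  show "Jstar (SS' n) pcomp \<subseteq> Dstar (SS' n) pcomp"
  proof clarify
    fix a b assume "(a, b) \<in> Jstar (SS' n) pcomp"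
    then have ab: "a \<in> SS' n" "b \<in> SS' n"
      and eq: "principal_star_ideal (SS' n) pcomp a = principal_star_ideal (SS' n) pcomp b"
      by (auto simp: Jstar_def)
    have mem: "x \<in> principal_star_ideal (SS' n) pcomp x" for x
      by (auto simp: principal_star_ideal_def)
    \<comment> \<open>Each of \<open>a\<close> and \<open>b\<close> lies in the principal star ideal
      of the other, so each rank bounds the other.\<close>
    have "card (ran a) = card (ran b)"
      using card_ran_le_if_mem_principal_star_ideal[OF assms ab(1), of b]
        card_ran_le_if_mem_principal_star_ideal[OF assms ab(2), of a] mem[of a] mem[of b] eq
      by auto
    then show "(a, b) \<in> Dstar (SS' n) pcomp"
      by (rule Dstar_if_card_ran_eq[OF assms ab])
  qed
qed (rule Dstar_subset_Jstar)

end
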